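(* Let $n\ge 1$ and let $\mu=(\mu_1,\mu_2,\ldots,\mu_n)$ be a partition of length $\ell(\mu)=n$ whose parts are all distinct, and put $m=\mu_1$. Then the mapping $\Psi=\phi^{-1}\circ\psi$ defines a bijection between the set $\mathcal{ST}^\mu(n,\overline n)$ of $sp(2n)$-standard shifted tableaux of shape $SF^\mu$ and the set $\mathcal{UA}^\mu(2n)$ of $2n\times m$ $\mu$-alternating sign matrices with a U-turn boundary.
   Context: Shifted diagram: for a partition $\mu$ with $n$ distinct positive parts, $SF^\mu=\{(i,j): 1\le i\le n,\ i\le j\le \mu_i+i-1\}$ (row $i$, column $j$). Alphabet: $[n,\overline n]=\{1,\ldots,n\}\cup\{\overline1,\ldots,\overline n\}$ ordered by $\overline1<1<\overline2<2<\cdots<\overline n<n$. $\mathcal{ST}^\mu(n,\overline n)$ is the set of fillings $ST=(\eta_{ij})_{(i,j)\in SF^\mu}$ with $\eta_{ij}\in[n,\overline n]$ such that $\eta_{ii}\in\{i,\overline i\}$ for $1\le i\le n$; $\eta_{ij}\le\eta_{i,j+1}$; $\eta_{ij}\le\eta_{i+1,j}$; and $\eta_{ij}<\eta_{i+1,j+1}$, whenever the boxes concerned lie in $SF^\mu$. $\mathcal{UA}^\mu(2n)$ (with $m=\mu_1$) is the set of $2n\times m$ matrices $UA=(a_{iq})$ with: (UA1) $a_{iq}\in\{-1,0,1\}$; (UA2) $\sum_{q=p}^m a_{iq}\in\{0,1\}$ for $1\le i\le 2n$, $1\le p\le m$; (UA3) $\sum_{i=j}^{2n}a_{iq}\in\{0,1\}$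 for $1\le j\le 2n$, $1\le q\le m$; (UA4) $\sum_{q=1}^m(a_{2i-1,q}+a_{2i,q})=1$ for $1\le i\le n$; (UA5) for $1\le q\le m$, $\sum_{i=1}^{2n}a_{iq}=1$ if $q=\mu_k$ for some $k$, and $=0$ otherwise. The map $\psi$: label the rows of $2n\times m$ matrices from top to bottom by $n,\overline n,n-1,\overline{n-1},\ldots,1,\overline1$. For $ST\in\mathcal{ST}^\mu(n,\overline n)$, $\psi(ST)$ is the $2n\times m$ matrix of signs whose entry in the row labelled $c\in[n,\overline n]$ and column $q$ is $+$ if the entry $c$ occurs in $ST$ on the $q$-th diagonal $\{(i,i+q-1)\}$ of $SF^\mu$, and $-$ otherwise. The map $\phi$: for $UA\in\mathcal{UA}^\mu(2n)$, a zero entry is called positive if the nearest non-zero entry to its right in the same row exists and equals $1$; all other zeros are negative. $\phi(UA)$ is the sign matrix obtained by replacing $1$'s and positive zeros by $+$, and $-1$'s and negative zeros by $-$. The inverse $\phi^{-1}$ is applied to a sign matrix row by row: the right-most $+$ of each maximal run of consecutive $+$'s becomes $1$ and the other $+$'s become $0$; the right-most $-$ of each maximal run of consecutive $-$'s becomes $-1$ if its immediate right-hand neighbour is (exists and is) $+$; all other $-$'s become $0$. *)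

theory Defs
  imports Main "HOL-Library.FuncSet"
begin

text \<open>
  Tableaux and matrices are functions on pairs (row, column), indexed from 1 as in the paper and
  made extensional by \<^term>\<open>PiE\<close>, so that two of them are equal iff they agree on their boxes.
  A partition with \<open>n\<close> parts is a function \<open>\<mu>\<close> on \<open>{1..n}\<close>; no other value of \<open>\<mu>\<close> is ever used.
\<close>

definition strict_partition :: "nat \<Rightarrow> (nat \<Rightarrow> nat) \<Rightarrow> bool" where
  "strict_partition n \<mu> \<longleftrightarrow>
     (\<forall>i\<in>{1..n}. 0 < \<mu> i) \<and> (\<forall>i\<in>{1..n}. \<forall>j\<in>{1..n}. i < j \<longrightarrow> \<mu> j < \<mu> i)"

definition SF :: "nat \<Rightarrow> (nat \<Rightarrow> nat) \<Rightarrow> (nat \<times> nat) set" where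
  "SF n \<mu> = {(i, j). 1 \<le> i \<and> i \<le> n \<and> i \<le> j \<and> j \<le> \<mu> i + i - 1}"

datatype letter = Bar nat | Plain nat

text \<open>The order \<open>Bar 1 < Plain 1 < Bar 2 < Plain 2 < \<dots>\<close>.\<close>

fun rank :: "letter \<Rightarrow> nat" where
  "rank (Bar k) = 2 * k"
| "rank (Plain k) = 2 * k + 1"

lemma rank_eq_iff: "rank a = rank b \<longleftrightarrow> a = b"
  by (cases a; cases b; simp; presburger)

instantiation letter :: linorder
begin

definition less_eq_letter :: "letter \<Rightarrow> letter \<Rightarrow> bool" where
  "a \<le> b \<longleftrightarrow> rank a \<le> rank b"

definition less_letter :: "letter \<Rightarrow> letter \<Rightarrow> bool" where
  "a < b \<longleftrightarrow> rank a < rank b"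

instance
  by standard (auto simp: less_eq_letter_def less_letter_def rank_eq_iff)

end

definition alphabet :: "nat \<Rightarrow> letter set" where
  "alphabet n = Plain ` {1..n} \<union> Bar ` {1..n}"

definition ST :: "nat \<Rightarrow> (nat \<Rightarrow> nat) \<Rightarrow> (nat \<times> nat \<Rightarrow> letter) set" where
  "ST n \<mu> = {\<eta> \<in> SF n \<mu> \<rightarrow>\<^sub>E alphabet n.
     (\<forall>i\<in>{1..n}. \<eta> (i, i) \<in> {Plain i, Bar i}) \<and>
     (\<forall>i j. (i, j) \<in> SF n \<mu> \<and> (i, j + 1) \<in> SF n \<mu> \<longrightarrow> \<eta> (i, j) \<le> \<eta> (i, j + 1)) \<and>
     (\<forall>i j. (i, j) \<in> SF n \<mu> \<and> (i + 1, j) \<in> SF n \<mu> \<longrightarrow> \<eta> (i, j) \<le> \<eta> (i + 1, j)) \<and>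
     (\<forall>i j. (i, j) \<in> SF n \<mu> \<and> (i + 1, j + 1) \<in> SF n \<mu> \<longrightarrow> \<eta> (i, j) < \<eta> (i + 1, j + 1))}"

definition UA :: "nat \<Rightarrow> (nat \<Rightarrow> nat) \<Rightarrow> (nat \<times> nat \<Rightarrow> int) set" where
  "UA n \<mu> = {a \<in> {1..2 * n} \<times> {1..\<mu> 1} \<rightarrow>\<^sub>E {-1, 0, 1}.
     (\<forall>i\<in>{1..2 * n}. \<forall>p\<in>{1..\<mu> 1}. (\<Sum>q=p..\<mu> 1. a (i, q)) \<in> {0, 1}) \<and>
     (\<forall>j\<in>{1..2 * n}. \<forall>q\<in>{1..\<mu> 1}. (\<Sum>i=j..2 * n. a (i, q)) \<in> {0, 1}) \<and>
     (\<forall>i\<in>{1..n}. (\<Sum>q=1..\<mu> 1. a (2 * i - 1, q) + a (2 * i, q)) = 1) \<and>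
     (\<forall>q\<in>{1..\<mu> 1}. (\<Sum>i=1..2 * n. a (i, q)) = (if \<exists>k\<in>{1..n}. q = \<mu> k then 1 else 0))}"

datatype sign = Plus | Minus

text \<open>Rows \<open>1, 2, 3, 4, \<dots>\<close> are labelled \<open>Plain n, Bar n, Plain (n - 1), Bar (n - 1), \<dots>\<close>.\<close>

definition row_label :: "nat \<Rightarrow> nat \<Rightarrow> letter" where
  "row_label n r = (if odd r then Plain (n - (r - 1) div 2) else Bar (n - (r - 1) div 2))"

definition psi :: "nat \<Rightarrow> (nat \<Rightarrow> nat) \<Rightarrow> (nat \<times> nat \<Rightarrow> letter) \<Rightarrow> (nat \<times> nat \<Rightarrow> sign)" where
  "psi n \<mu> \<eta> = (\<lambda>(r, q) \<in> {1..2 * n} \<times> {1..\<mu> 1}.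
     if \<exists>i. (i, i + q - 1) \<in> SF n \<mu> \<and> \<eta> (i, i + q - 1) = row_label n r then Plus else Minus)"

definition positive_zero :: "nat \<Rightarrow> (nat \<times> nat \<Rightarrow> int) \<Rightarrow> nat \<Rightarrow> nat \<Rightarrow> bool" where
  "positive_zero m a i q \<longleftrightarrow>
     a (i, q) = 0 \<and> (\<exists>p\<in>{q<..m}. a (i, p) = 1 \<and> (\<forall>k\<in>{q<..<p}. a (i, k) = 0))"

definition phi :: "nat \<Rightarrow> (nat \<Rightarrow> nat) \<Rightarrow> (nat \<times> nat \<Rightarrow> int) \<Rightarrow> (nat \<times> nat \<Rightarrow> sign)" where
  "phi n \<mu> a = (\<lambda>(i, q) \<in> {1..2 * n} \<times> {1..\<mu> 1}.
     if a (i, q) = 1 \<or> positive_zero (\<mu> 1) a i q then Plus else Minus)"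

text \<open>
  The right-most \<open>Plus\<close> of a maximal run of \<open>Plus\<close> is one in the last column or with a \<open>Minus\<close>
  to its right.  The lemmas \<open>phi_inv_phi\<close> and \<open>phi_phi_inv\<close> below justify the name.
\<close>

definition phi_inv :: "nat \<Rightarrow> (nat \<Rightarrow> nat) \<Rightarrow> (nat \<times> nat \<Rightarrow> sign) \<Rightarrow> (nat \<times> nat \<Rightarrow> int)" where
  "phi_inv n \<mu> S = (\<lambda>(i, q) \<in> {1..2 * n} \<times> {1..\<mu> 1}.
     if S (i, q) = Plus \<and> (q = \<mu> 1 \<or> S (i, q + 1) = Minus) then 1
     else if S (i, q) = Minus \<and> q < \<mu> 1 \<and> S (i, q + 1) = Plus then -1
     else 0)"

definition Psi :: "nat \<Rightarrow> (nat \<Rightarrow> nat) \<Rightarrow> (nat \<times> nat \<Rightarrow> letter) \<Rightarrow> (nat \<times> nat \<Rightarrow> int)" where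
  "Psi n \<mu> = phi_inv n \<mu> \<circ> psi n \<mu>"

lemma positive_zero_step:
  "positive_zero m a i q \<longleftrightarrow>
     a (i, q) = 0 \<and> q < m \<and> (a (i, q + 1) = 1 \<or> positive_zero m a i (q + 1))"
proof -
  have "(\<exists>p\<in>{q<..m}. a (i, p) = 1 \<and> (\<forall>k\<in>{q<..<p}. a (i, k) = 0)) \<longleftrightarrow>
     q < m \<and> (a (i, q + 1) = 1 \<or> a (i, q + 1) = 0 \<and>
       (\<exists>p\<in>{q + 1<..m}. a (i, p) = 1 \<and> (\<forall>k\<in>{q + 1<..<p}. a (i, k) = 0)))"
    (is "?L \<longleftrightarrow> ?R")
  proof
    assume ?L
    then obtain p where p: "q < p" "p \<le> m" "a (i, p) = 1" "\<forall>k\<in>{q<..<p}. a (i, k) = 0"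
      by auto
    show ?R
    proof (cases "p = q + 1")
      case True
      with p show ?thesis by auto
    next
      case False
      with p have "p \<in> {q + 1<..m}" "q + 1 \<in> {q<..<p}" by auto
      with p show ?thesis by force
    qed
  next
    assume R: ?R
    show ?L
    proof (cases "a (i, q + 1) = 1")
      case True
      with R show ?thesis by (intro bexI[of _ "q + 1"]) auto
    next
      case False
      with R obtain p where p: "q + 1 < p" "p \<le> m" "a (i, p) = 1" "a (i, q + 1) = 0"
        "\<forall>k\<in>{q + 1<..<p}. a (i, k) = 0" by auto
      have "a (i, k) = 0" if "k \<in> {q<..<p}" for k
        using p that by (cases "k = q + 1") auto
      with p show ?thesis by (intro bexI[of _ p]) auto
    qed
  qed
  then show ?thesis
    unfolding positive_zero_def by blast
qed

lemma phi_inv_phi: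
  assumes a: "a \<in> UA n \<mu>"
  shows "phi_inv n \<mu> (phi n \<mu> a) = a"
proof (rule ext, clarify)
  fix i q
  let ?m = "\<mu> 1" and ?s = "\<lambda>q. \<Sum>k=q..\<mu> 1. a (i, k)"
  show "phi_inv n \<mu> (phi n \<mu> a) (i, q) = a (i, q)"
  proof (cases "i \<in> {1..2 * n} \<and> q \<in> {1..?m}")
    case False
    then have "a (i, q) = undefined"
      using a by (intro PiE_arb[of a "{1..2 * n} \<times> {1..?m}"]) (auto simp: UA_def)
    with False show ?thesis by (auto simp: phi_inv_def)
  next
    case True
    then have i: "i \<in> {1..2 * n}" and q: "1 \<le> q" "q \<le> ?m" by auto
    have val: "a (i, k) \<in> {-1, 0, 1}" if "1 \<le> k" "k \<le> ?m" for k
      using a i that by (auto simp: UA_def dest!: PiE_mem)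
    have s01: "?s k \<in> {0, 1}" if "1 \<le> k" for k
      using a i that by (cases "k \<le> ?m") (auto simp: UA_def)
    have s_step: "?s k = a (i, k) + ?s (k + 1)" if "k \<le> ?m" for k
      using that by (simp add: sum.atLeast_Suc_atMost)
    have key: "a (i, k) = 1 \<or> positive_zero ?m a i k \<longleftrightarrow> ?s k = 1" if "k \<le> ?m" "1 \<le> k" for k
      using that
    proof (induction rule: inc_induct)
      case base
      then show ?case using positive_zero_step[of ?m a i ?m] by simp
    next
      case (step k)
      have IH: "a (i, k + 1) = 1 \<or> positive_zero ?m a i (k + 1) \<longleftrightarrow> ?s (k + 1) = 1"
        using step by simp
      have "positive_zero ?m a i k \<longleftrightarrow> a (i, k) = 0 \<and> ?s (k + 1) = 1"
        using positive_zero_step[of ?m a i k] IH step.hyps by simp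
      moreover have "?s k \<in> {0, 1}" "?s (k + 1) \<in> {0, 1}" "?s k = a (i, k) + ?s (k + 1)"
        using s01[of k] s01[of "k + 1"] s_step[of k] step by simp_all
      ultimately show ?case by auto
    qed
    have P: "phi n \<mu> a (i, k) = (if ?s k = 1 then Plus else Minus)" if "1 \<le> k" "k \<le> ?m" for k
      using key[of k] that i by (simp add: phi_def)
    have "?s q \<in> {0, 1}" "?s (q + 1) \<in> {0, 1}" "?s q = a (i, q) + ?s (q + 1)"
      using s01[of q] s01[of "q + 1"] s_step[of q] q by simp_all
    moreover have "?s (q + 1) = 0" if "q = ?m" using that by simp
    moreover have "phi n \<mu> a (i, q) = (if ?s q = 1 then Plus else Minus)"
      using P q by blast
    moreover have "phi n \<mu> a (i, q + 1) = (if ?s (q + 1) = 1 then Plus else Minus)" if "q < ?m"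
      using P[of "q + 1"] q that by simp
    moreover have "phi_inv n \<mu> (phi n \<mu> a) (i, q) =
      (if phi n \<mu> a (i, q) = Plus \<and> (q = ?m \<or> phi n \<mu> a (i, q + 1) = Minus) then 1
       else if phi n \<mu> a (i, q) = Minus \<and> q < ?m \<and> phi n \<mu> a (i, q + 1) = Plus then -1 else 0)"
      using i q by (simp add: phi_inv_def)
    ultimately show ?thesis using q
      by (cases "q = ?m") (auto split: if_splits)
  qed
qed

lemma phi_phi_inv:
  assumes S: "S \<in> extensional ({1..2 * n} \<times> {1..\<mu> 1})"
  shows "phi n \<mu> (phi_inv n \<mu> S) = S"
proof (rule ext, clarify)
  fix i q
  let ?m = "\<mu> 1" and ?a = "phi_inv n \<mu> S"
  show "phi n \<mu> ?a (i, q) = S (i, q)"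
  proof (cases "i \<in> {1..2 * n} \<and> q \<in> {1..?m}")
    case False
    with S show ?thesis by (auto simp: phi_def extensional_def)
  next
    case True
    then have i: "i \<in> {1..2 * n}" and q: "1 \<le> q" "q \<le> ?m" by auto
    have val: "?a (i, k) =
      (if S (i, k) = Plus \<and> (k = ?m \<or> S (i, k + 1) = Minus) then 1
       else if S (i, k) = Minus \<and> k < ?m \<and> S (i, k + 1) = Plus then -1 else 0)"
      if "1 \<le> k" "k \<le> ?m" for k
      using that i by (simp add: phi_inv_def)
    have key: "?a (i, k) = 1 \<or> positive_zero ?m ?a i k \<longleftrightarrow> S (i, k) = Plus"
      if "k \<le> ?m" "1 \<le> k" for k
      using that
    proof (induction rule: inc_induct)
      case base
      then show ?case using positive_zero_step[of ?m ?a i ?m] val[of ?m]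
        by (auto split: if_splits)
    next
      case (step k)
      have "positive_zero ?m ?a i k \<longleftrightarrow> ?a (i, k) = 0 \<and> S (i, k + 1) = Plus"
        using positive_zero_step[of ?m ?a i k] step by simp
      then show ?case
        using val[of k] step.hyps step.prems
        by (cases "S (i, k)"; cases "S (i, k + 1)") auto
    qed
    from key[of q] i q show ?thesis
      by (cases "S (i, q)") (auto simp: phi_def)
  qed
qed

end

theory Submission
  imports Defs
begin

text \<open>
  Let \<open>D q\<close> be the set of letters on the \<open>q\<close>-th diagonal. Strict increase along diagonals says that
  a tableau is determined by the sets \<open>D q\<close>, and the row and column conditions say that
  consecutive diagonals interlace, i.e. that
  \<open>card {x \<in> D q. x \<le> c} - card {x \<in> D (q + 1). x \<le> c} \<in> {0, 1}\<close> for every letter \<open>c\<close>.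
  On the matrix side the entry of \<open>Psi\<close> in the row labelled \<open>c\<close> and column \<open>q\<close> is
  \<open>[c \<in> D q] - [c \<in> D (q + 1)]\<close>. Row sums therefore telescope, and the partial column sums,
  taken from the bottom row upwards, are exactly the differences of cardinalities above.
\<close>

section \<open>Increasing enumerations\<close>

text \<open>A member \<open>i\<close> puts all of \<open>{1..i}\<close> into \<open>A\<close>, while
  a non-member confines \<open>A\<close> to \<open>{1..<i}\<close>, so \<open>A\<close> is
  \<open>{1..card A}\<close>. This is applied both to positions along a diagonal and to the rows
  that meet a diagonal.\<close>

lemma downclosed_mem_iff:
  fixes A :: "nat set"
  assumes fin: "finite A" and pos: "0 \<notin> A"
    and down: "\<And>i j. j \<in> A \<Longrightarrow> 1 \<le> i \<Longrightarrow> i \<le> j \<Longrightarrow> i \<in> A"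
  shows "i \<in> A \<longleftrightarrow> 1 \<le> i \<and> i \<le> card A"
proof (cases "i = 0")
  case True
  then show ?thesis using pos by simp
next
  case i: False
  show ?thesis
  proof (cases "i \<in> A")
    case True
    then have "{1..i} \<subseteq> A" using down by auto
    from card_mono[OF fin this] show ?thesis using True i by simp
  next
    case False
    have "A \<subseteq> {1..<i}"
    proof
      fix j assume j: "j \<in> A"
      then have "j \<noteq> 0" using pos by metis
      moreover have "\<not> i \<le> j" using down[OF j, of i] False i by auto
      ultimately show "j \<in> {1..<i}" by simp
    qed
    from card_mono[OF _ this] have "card A \<le> i - 1" by simp
    then show ?thesis using False i by simp
  qed
qed

text \<open>The positions with value at most \<open>c\<close> form an initial segment, which
  \<open>f\<close> carries injectively onto the values at most \<open>c\<close>. Comparisons of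
  entries thereby become comparisons of counts, which depend on the image alone.\<close>

lemma strict_mono_on_le_iff:
  fixes f :: "nat \<Rightarrow> 'a::linorder"
  assumes f: "strict_mono_on {1..l} f" and k: "k \<in> {1..l}"
  shows "f k \<le> c \<longleftrightarrow> k \<le> card {x \<in> f ` {1..l}. x \<le> c}"
proof -
  let ?A = "{i \<in> {1..l}. f i \<le> c}"
  have mono: "f i \<le> f j" if "1 \<le> i" "i \<le> j" "j \<le> l" for i j
    using strict_mono_on_leD[OF f, of i j] that by simp
  have "k \<in> ?A \<longleftrightarrow> 1 \<le> k \<and> k \<le> card ?A"
  proof (rule downclosed_mem_iff)
    fix i j assume "j \<in> ?A" "1 \<le> i" "i \<le> j"
    then show "i \<in> ?A" using mono[of i j] by auto
  qed auto
  moreover have "card ?A = card (f ` ?A)"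
    by (rule card_image[symmetric], rule inj_on_subset[OF strict_mono_on_imp_inj_on[OF f]]) auto
  moreover have "f ` ?A = {x \<in> f ` {1..l}. x \<le> c}" by auto
  ultimately show ?thesis using k by auto
qed

text \<open>Equal images give equal counts, so \<open>f k\<close> and \<open>g k\<close> have the
  same upper bounds; each is then a bound for the other.\<close>

lemma strict_mono_on_unique:
  fixes f g :: "nat \<Rightarrow> 'a::linorder"
  assumes f: "strict_mono_on {1..l} f" and g: "strict_mono_on {1..l} g"
    and "f ` {1..l} = g ` {1..l}" and k: "k \<in> {1..l}"
  shows "f k = g k"
  using strict_mono_on_le_iff[OF f k] strict_mono_on_le_iff[OF g k] assms(3)
  by (metis order_antisym order_refl)

lemma strict_mono_on_enumeration:
  fixes A :: "'a::linorder set"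
  assumes "finite A"
  obtains f where "strict_mono_on {1..card A} f" "f ` {1..card A} = A"
proof
  let ?f = "\<lambda>i. sorted_list_of_set A ! (i - 1)"
  show "strict_mono_on {1..card A} ?f"
    using strict_sorted_list_of_set[of A]
    by (auto intro!: strict_mono_onI simp: sorted_wrt_iff_nth_less)
  have "?f ` {1..card A} = (!) (sorted_list_of_set A) ` {..<card A}"
  proof -
    have "(\<lambda>i. i - 1) ` {1..card A} = {..<card A}"
      by (auto simp: image_iff intro!: bexI[of _ "Suc _"])
    then show ?thesis by (metis image_image)
  qed
  also have "\<dots> = set (sorted_list_of_set A)"
    by (simp add: set_conv_nth lessThan_def) (auto simp: image_iff)
  finally show "?f ` {1..card A} = A" using assms by simp
qed

text \<open>By \<open>strict_mono_on_le_iff\<close>, bounds on values are bounds on positions by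
  counts. The inequality \<open>f i \<le> g i\<close> comes from comparing counts at
  \<open>c = g i\<close>, and \<open>g i \<le> f (i + 1)\<close> from comparing them at
  \<open>c = f (i + 1)\<close>, which is why \<open>A\<close> must contain all values. Conversely,
  the inequalities at the last counted positions bound the counts.\<close>

lemma interlacing_iff:
  fixes f g :: "nat \<Rightarrow> 'a::linorder"
  assumes f: "strict_mono_on {1..l} f" and g: "strict_mono_on {1..l'} g"
    and l: "l' \<le> l" "l \<le> l' + 1"
    and A: "f ` {1..l} \<subseteq> A" "g ` {1..l'} \<subseteq> A"
  shows "(\<forall>i. 1 \<le> i \<and> i \<le> l' \<longrightarrow> f i \<le> g i) \<and> (\<forall>i. 1 \<le> i \<and> i + 1 \<le> l \<longrightarrow> g i \<le> f (i + 1)) \<longleftrightarrow>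
    (\<forall>c\<in>A. int (card {x \<in> f ` {1..l}. x \<le> c}) - int (card {x \<in> g ` {1..l'}. x \<le> c}) \<in> {0, 1})"
    (is "?L \<longleftrightarrow> (\<forall>c\<in>A. int (?F c) - int (?G c) \<in> {0, 1})")
proof -
  have F: "f k \<le> c \<longleftrightarrow> k \<le> ?F c" if "1 \<le> k" "k \<le> l" for k c
    using strict_mono_on_le_iff[OF f, of k c] that by simp
  have G: "g k \<le> c \<longleftrightarrow> k \<le> ?G c" if "1 \<le> k" "k \<le> l'" for k c
    using strict_mono_on_le_iff[OF g, of k c] that by simp
  have Fl: "?F c \<le> l" for c
  proof -
    have "?F c \<le> card (f ` {1..l})" by (intro card_mono) auto
    also have "\<dots> \<le> l" using card_image_le[of "{1..l}" f] by simp
    finally show ?thesis .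
  qed
  have Gl: "?G c \<le> l'" for c
  proof -
    have "?G c \<le> card (g ` {1..l'})" by (intro card_mono) auto
    also have "\<dots> \<le> l'" using card_image_le[of "{1..l'}" g] by simp
    finally show ?thesis .
  qed
  have "?L \<longleftrightarrow> (\<forall>c\<in>A. ?G c \<le> ?F c \<and> ?F c \<le> ?G c + 1)"
  proof (intro iffI conjI ballI allI impI)
    fix c assume L: ?L
    show "?G c \<le> ?F c"
    proof (cases "?G c = 0")
      case False
      then have pos: "1 \<le> ?G c" by linarith
      then have "g (?G c) \<le> c" using G[OF _ Gl] by blast
      moreover have "f (?G c) \<le> g (?G c)" using L pos Gl by blast
      ultimately have "f (?G c) \<le> c" by order
      then show ?thesis using F[OF pos order_trans[OF Gl l(1)]] by blast
    qed linarith
    show "?F c \<le> ?G c + 1"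
    proof (cases "?F c \<le> 1")
      case False
      \<comment> \<open>The position before the last one counted for \<open>f\<close> exists in
        \<open>g\<close> as well, since \<open>?F c \<le> l\<close> and
        \<open>l \<le> l' + 1\<close>.\<close>
      define k where "k = ?F c - 1"
      have k: "?F c = k + 1" "1 \<le> k" "k \<le> l'" "k + 1 \<le> l"
        using False Fl[of c] l by (auto simp: k_def)
      then have "f (k + 1) \<le> c" using F[of "k + 1" c] by simp
      moreover have "g k \<le> f (k + 1)" using L k by simp
      ultimately have "g k \<le> c" by order
      then show ?thesis using G[of k c] k by simp
    qed simp
  next
    fix i assume R: "\<forall>c\<in>A. ?G c \<le> ?F c \<and> ?F c \<le> ?G c + 1" and i: "1 \<le> i \<and> i \<le> l'"
    have "i \<le> ?G (g i)" using G[of i "g i"] i by simp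
    moreover have "g i \<in> A" using A i by auto
    then have "?G (g i) \<le> ?F (g i)" using R by blast
    ultimately show "f i \<le> g i" using F[of i "g i"] i l by simp
  next
    fix i assume R: "\<forall>c\<in>A. ?G c \<le> ?F c \<and> ?F c \<le> ?G c + 1" and i: "1 \<le> i \<and> i + 1 \<le> l"
    have "i + 1 \<le> ?F (f (i + 1))" using F[of "i + 1" "f (i + 1)"] i by simp
    moreover have "f (i + 1) \<in> A" using A i by auto
    then have "?F (f (i + 1)) \<le> ?G (f (i + 1)) + 1" using R by blast
    ultimately show "g i \<le> f (i + 1)" using G[of i "f (i + 1)"] i l by simp
  qed
  also have "\<dots> \<longleftrightarrow> (\<forall>c\<in>A. int (?F c) - int (?G c) \<in> {0, 1})"
    by (intro ball_cong refl) auto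
  finally show ?thesis .
qed

section \<open>Letters and row labels\<close>

text \<open>The ranks of the letters fill an interval without gaps, so questions about order and
  membership reduce to linear arithmetic.\<close>

lemma mem_alphabet_iff: "c \<in> alphabet n \<longleftrightarrow> 2 \<le> rank c \<and> rank c \<le> 2 * n + 1"
  by (cases c) (auto simp: alphabet_def image_iff)

lemma rank_row_label:
  assumes "r \<in> {1..2 * n}"
  shows "rank (row_label n r) = 2 * n + 2 - r"
proof (cases "odd r")
  case True
  then show ?thesis using assms by (auto simp: row_label_def elim!: oddE)
next
  case False
  then obtain k where "r = 2 * k" by (auto elim: evenE)
  moreover from this have "(r - 1) div 2 = k - 1" using assms by auto
  ultimately show ?thesis using assms by (auto simp: row_label_def)
qed

lemma row_label_le_iff:
  assumes "r \<in> {1..2 * n}" "s \<in> {1..2 * n}"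
  shows "row_label n r \<le> row_label n s \<longleftrightarrow> s \<le> r"
  using assms by (auto simp: less_eq_letter_def rank_row_label)

lemma bij_betw_row_label: "bij_betw (row_label n) {1..2 * n} (alphabet n)"
proof (rule bij_betw_imageI)
  show "inj_on (row_label n) {1..2 * n}"
    by (intro inj_onI order_antisym) (metis order_refl row_label_le_iff)+
  show "row_label n ` {1..2 * n} = alphabet n"
  proof
    show "row_label n ` {1..2 * n} \<subseteq> alphabet n"
      by (auto simp: mem_alphabet_iff rank_row_label)
    show "alphabet n \<subseteq> row_label n ` {1..2 * n}"
    proof
      fix c assume c: "c \<in> alphabet n"
      let ?r = "2 * n + 2 - rank c"
      have "?r \<in> {1..2 * n}" using c by (auto simp: mem_alphabet_iff)
      moreover from this have "row_label n ?r = c"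
        using c by (intro rank_eq_iff[THEN iffD1]) (auto simp: mem_alphabet_iff rank_row_label)
      ultimately show "c \<in> row_label n ` {1..2 * n}" by (metis imageI)
    qed
  qed
qed

lemma finite_alphabet: "finite (alphabet n)"
  by (simp add: alphabet_def)

text \<open>Labels decrease from top to bottom, so the rows from \<open>j\<close> down to the last
  carry exactly the letters up to \<open>row_label n j\<close>. A partial column sum taken from the
  bottom is therefore a count of small letters.\<close>

lemma sum_of_bool_row_label:
  assumes "C \<subseteq> alphabet n" "j \<in> {1..2 * n}"
  shows "(\<Sum>r=j..2 * n. of_bool (row_label n r \<in> C)) = int (card {x \<in> C. x \<le> row_label n j})"
proof -
  let ?R = "{j..2 * n} \<inter> {r. row_label n r \<in> C}"
  have "row_label n ` ?R = {x \<in> C. x \<le> row_label n j}"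
  proof (intro equalityI subsetI)
    fix x assume x: "x \<in> {x \<in> C. x \<le> row_label n j}"
    then have "x \<in> row_label n ` {1..2 * n}"
      using assms bij_betw_imp_surj_on[OF bij_betw_row_label[of n]] by blast
    then obtain r where "r \<in> {1..2 * n}" "x = row_label n r" by blast
    then show "x \<in> row_label n ` ?R" using x assms row_label_le_iff[of r n j] by auto
  qed (use assms in \<open>auto simp: row_label_le_iff\<close>)
  moreover have "inj_on (row_label n) ?R"
    using assms by (intro inj_on_subset[OF bij_betw_imp_inj_on[OF bij_betw_row_label[of n]]]) auto
  ultimately have "card {x \<in> C. x \<le> row_label n j} = card ?R"
    using card_image[of "row_label n" ?R] by (simp only:)
  moreover have "(\<Sum>r=j..2 * n. of_bool (row_label n r \<in> C)) = int (card ?R)"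
    by simp
  ultimately show ?thesis by simp
qed

section \<open>Sign matrices as sequences of sets of letters\<close>

text \<open>The condition on \<open>q\<close> makes the set empty outside the matrix. Emptiness in
  column \<open>m + 1\<close> plays the role of a column of \<open>Minus\<close> to the right of the
  last one.\<close>

definition plus_letters :: "nat \<Rightarrow> nat \<Rightarrow> (nat \<times> nat \<Rightarrow> sign) \<Rightarrow> nat \<Rightarrow> letter set" where
  "plus_letters n m S q = {row_label n r | r. r \<in> {1..2 * n} \<and> q \<in> {1..m} \<and> S (r, q) = Plus}"

text \<open>Row \<open>i\<close> meets the \<open>q\<close>-th diagonal iff
  \<open>q \<le> \<mu> i\<close>, so this is the number of boxes on that diagonal; it is also the
  \<open>q\<close>-th part of the conjugate partition.\<close>

definition diag_length :: "nat \<Rightarrow> (nat \<Rightarrow> nat) \<Rightarrow> nat \<Rightarrow> nat" where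
  "diag_length n \<mu> q = card {i \<in> {1..n}. q \<le> \<mu> i}"

lemma plus_letters_subset: "plus_letters n m S q \<subseteq> alphabet n"
  unfolding plus_letters_def using bij_betw_imp_surj_on[OF bij_betw_row_label[of n]] by blast

lemma row_label_mem_plus_letters_iff:
  assumes "r \<in> {1..2 * n}"
  shows "row_label n r \<in> plus_letters n m S q \<longleftrightarrow> q \<in> {1..m} \<and> S (r, q) = Plus"
  unfolding plus_letters_def
  using inj_onD[OF bij_betw_imp_inj_on[OF bij_betw_row_label[of n]] _ assms] assms by blast

lemma sign_matrix_eqI:
  assumes S: "S \<in> extensional ({1..2 * n} \<times> {1..m})" and T: "T \<in> extensional ({1..2 * n} \<times> {1..m})"
    and eq: "\<And>q. q \<in> {1..m} \<Longrightarrow> plus_letters n m S q = plus_letters n m T q"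
  shows "S = T"
proof (rule extensionalityI[OF S T])
  fix x assume "x \<in> {1..2 * n} \<times> {1..m}"
  then obtain r q where x: "x = (r, q)" "r \<in> {1..2 * n}" "q \<in> {1..m}" by auto
  then have "S (r, q) = Plus \<longleftrightarrow> T (r, q) = Plus"
    using eq[of q] row_label_mem_plus_letters_iff[of r n] by blast
  then show "S x = T x" using x by (cases "S x"; cases "T x") auto
qed

text \<open>With an empty set beyond the last column, the rules for runs of \<open>Plus\<close> and
  of \<open>Minus\<close> merge into one difference of indicators, with no boundary case.\<close>

lemma phi_inv_eq:
  assumes "r \<in> {1..2 * n}" "q \<in> {1..\<mu> 1}"
  shows "phi_inv n \<mu> S (r, q) = of_bool (row_label n r \<in> plus_letters n (\<mu> 1) S q) -
    of_bool (row_label n r \<in> plus_letters n (\<mu> 1) S (q + 1))"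
  using assms
  by (cases "S (r, q)"; cases "S (r, q + 1)")
     (auto simp: phi_inv_def row_label_mem_plus_letters_iff simp del: One_nat_def)

lemma sum_telescope:
  fixes X :: "nat \<Rightarrow> int"
  assumes "p \<le> m"
  shows "(\<Sum>q=p..m. X q - X (q + 1)) = X p - X (m + 1)"
  using sum_Suc_diff[of p m "\<lambda>q. - X q"] assms by simp

text \<open>The differences telescope and the term beyond the last column vanishes. Hence every sign
  matrix satisfies the condition on partial row sums.\<close>

lemma row_sum_phi_inv:
  assumes "r \<in> {1..2 * n}" "p \<in> {1..\<mu> 1}"
  shows "(\<Sum>q=p..\<mu> 1. phi_inv n \<mu> S (r, q)) = of_bool (row_label n r \<in> plus_letters n (\<mu> 1) S p)"
proof -
  let ?X = "\<lambda>q. of_bool (row_label n r \<in> plus_letters n (\<mu> 1) S q) :: int"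
  have "(\<Sum>q=p..\<mu> 1. phi_inv n \<mu> S (r, q)) = (\<Sum>q=p..\<mu> 1. ?X q - ?X (q + 1))"
    using assms by (intro sum.cong phi_inv_eq) auto
  also have "\<dots> = ?X p - ?X (\<mu> 1 + 1)" using assms by (intro sum_telescope) auto
  also have "\<dots> = ?X p" by (simp add: plus_letters_def)
  finally show ?thesis .
qed

lemma column_sum_phi_inv:
  assumes "j \<in> {1..2 * n}" "q \<in> {1..\<mu> 1}"
  shows "(\<Sum>r=j..2 * n. phi_inv n \<mu> S (r, q)) =
    int (card {x \<in> plus_letters n (\<mu> 1) S q. x \<le> row_label n j}) -
    int (card {x \<in> plus_letters n (\<mu> 1) S (q + 1). x \<le> row_label n j})"
proof -
  have "(\<Sum>r=j..2 * n. phi_inv n \<mu> S (r, q)) =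
    (\<Sum>r=j..2 * n. of_bool (row_label n r \<in> plus_letters n (\<mu> 1) S q) -
      of_bool (row_label n r \<in> plus_letters n (\<mu> 1) S (q + 1)))"
    using assms by (intro sum.cong phi_inv_eq) auto
  then show ?thesis
    using assms by (simp only: sum_subtractf sum_of_bool_row_label plus_letters_subset)
qed

section \<open>Lengths of the diagonals of the shifted diagram\<close>

context
  fixes n :: nat and \<mu> :: "nat \<Rightarrow> nat"
  assumes n: "1 \<le> n" and \<mu>: "strict_partition n \<mu>"
begin

lemma parts_inj_on: "inj_on \<mu> {1..n}"
proof (rule inj_onI)
  fix i j assume "i \<in> {1..n}" "j \<in> {1..n}" "\<mu> i = \<mu> j"
  then show "i = j" using \<mu> unfolding strict_partition_def by (metis less_irrefl linorder_neqE_nat)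
qed

lemma parts_le: "i \<in> {1..n} \<Longrightarrow> \<mu> i \<le> \<mu> 1"
  using \<mu> n unfolding strict_partition_def
  by (cases "i = 1") (auto intro!: less_imp_le)

text \<open>Since the parts decrease, the rows long enough to reach the \<open>q\<close>-th diagonal
  form an initial segment of \<open>{1..n}\<close>.\<close>

lemma mem_SF_diag_iff:
  assumes "1 \<le> q"
  shows "(i, i + q - 1) \<in> SF n \<mu> \<longleftrightarrow> 1 \<le> i \<and> i \<le> diag_length n \<mu> q"
proof -
  have "(i, i + q - 1) \<in> SF n \<mu> \<longleftrightarrow> i \<in> {i \<in> {1..n}. q \<le> \<mu> i}"
    using assms by (auto simp: SF_def)
  also have "\<dots> \<longleftrightarrow> 1 \<le> i \<and> i \<le> diag_length n \<mu> q"
    unfolding diag_length_def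
  proof (rule downclosed_mem_iff)
    fix i j assume ij: "j \<in> {i \<in> {1..n}. q \<le> \<mu> i}" "1 \<le> i" "i \<le> j"
    then have "\<mu> j \<le> \<mu> i" using \<mu> unfolding strict_partition_def
      by (cases "i = j") (auto intro!: less_imp_le)
    then show "i \<in> {i \<in> {1..n}. q \<le> \<mu> i}" using ij by auto
  qed auto
  finally show ?thesis .
qed

lemma SF_cases:
  assumes "(i, j) \<in> SF n \<mu>"
  obtains q where "q \<in> {1..\<mu> 1}" "j = i + q - 1" "1 \<le> i" "i \<le> diag_length n \<mu> q"
proof
  have ij: "1 \<le> i" "i \<le> n" "i \<le> j" "j \<le> \<mu> i + i - 1" using assms by (auto simp: SF_def)
  show "j - i + 1 \<in> {1..\<mu> 1}" using ij parts_le[of i] by auto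
  show j: "j = i + (j - i + 1) - 1" using ij by simp
  show "1 \<le> i" "i \<le> diag_length n \<mu> (j - i + 1)"
    using assms mem_SF_diag_iff[of "j - i + 1" i] j by auto
qed

lemma diag_length_1: "diag_length n \<mu> 1 = n"
proof -
  have "{i \<in> {1..n}. 1 \<le> \<mu> i} = {1..n}" using \<mu> by (auto simp: strict_partition_def Suc_le_eq)
  then show ?thesis by (simp add: diag_length_def)
qed

lemma diag_length_beyond: "diag_length n \<mu> (\<mu> 1 + 1) = 0"
proof -
  have "{i \<in> {1..n}. \<mu> 1 + 1 \<le> \<mu> i} = {}" using parts_le by fastforce
  then show ?thesis by (simp add: diag_length_def del: One_nat_def)
qed

text \<open>The rows that reach diagonal \<open>q\<close> but not \<open>q + 1\<close> are those
  with \<open>\<mu> i = q\<close>, and distinctness of the parts allows at most one. Consecutive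
  lengths thus satisfy the length hypotheses of \<open>interlacing_iff\<close>.\<close>

lemma diag_length_step:
  "diag_length n \<mu> q = diag_length n \<mu> (q + 1) + (if \<exists>k\<in>{1..n}. q = \<mu> k then 1 else 0)"
proof -
  have "{i \<in> {1..n}. q \<le> \<mu> i} = {i \<in> {1..n}. q + 1 \<le> \<mu> i} \<union> {i \<in> {1..n}. q = \<mu> i}" by auto
  then have "diag_length n \<mu> q = diag_length n \<mu> (q + 1) + card {i \<in> {1..n}. q = \<mu> i}"
    unfolding diag_length_def by (simp only:) (rule card_Un_disjoint; auto)
  moreover have "card {i \<in> {1..n}. q = \<mu> i} = (if \<exists>k\<in>{1..n}. q = \<mu> k then 1 else 0)"
  proof (cases "\<exists>k\<in>{1..n}. q = \<mu> k")
    case True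
    then obtain k where k: "k \<in> {1..n}" "q = \<mu> k" by blast
    then have "{i \<in> {1..n}. q = \<mu> i} = {k}" by (auto dest: inj_onD[OF parts_inj_on])
    then show ?thesis using True by simp
  next
    case False
    then have "{i \<in> {1..n}. q = \<mu> i} = {}" by blast
    then show ?thesis using False by simp
  qed
  ultimately show ?thesis by simp
qed

lemma parts_1_pos: "1 \<le> \<mu> 1"
  using \<mu> n by (auto simp: strict_partition_def Suc_le_eq)

text \<open>Both sequences vanish at \<open>\<mu> 1 + 1\<close> and have the same successive
  differences, so descending induction identifies them. This turns the prescribed full column sums
  into prescribed cardinalities.\<close>

lemma card_steps_iff:
  assumes "N (\<mu> 1 + 1) = (0 :: nat)"
  shows "(\<forall>q\<in>{1..\<mu> 1}. int (N q) - int (N (q + 1)) = (if \<exists>k\<in>{1..n}. q = \<mu> k then 1 else 0)) \<longleftrightarrow>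
    (\<forall>q\<in>{1..\<mu> 1}. N q = diag_length n \<mu> q)" (is "?L \<longleftrightarrow> ?R")
proof
  assume L: ?L
  have "N q = diag_length n \<mu> q" if "q \<le> \<mu> 1 + 1" "1 \<le> q" for q
    using that
  proof (induction rule: inc_induct)
    case base
    then show ?case using assms diag_length_beyond by simp
  next
    case (step q)
    then show ?case using L diag_length_step[of q] by (auto split: if_splits)
  qed
  then show ?R by simp
next
  assume R: ?R
  then have N: "N q = diag_length n \<mu> q" if "1 \<le> q" "q \<le> \<mu> 1 + 1" for q
    using that assms diag_length_beyond by (cases "q = \<mu> 1 + 1") auto
  show ?L
  proof
    fix q assume "q \<in> {1..\<mu> 1}"
    then show "int (N q) - int (N (q + 1)) = (if \<exists>k\<in>{1..n}. q = \<mu> k then 1 else 0)"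
      using N[of q] N[of "q + 1"] diag_length_step[of q] by simp
  qed
qed

text \<open>The conditions on entries and on partial row sums hold for any sign matrix. The three
  conjuncts translate, in order, the partial column sums, the U-turn condition and the full column
  sums.\<close>

lemma phi_inv_mem_UA_iff:
  "phi_inv n \<mu> S \<in> UA n \<mu> \<longleftrightarrow>
    (\<forall>c\<in>alphabet n. \<forall>q\<in>{1..\<mu> 1}. int (card {x \<in> plus_letters n (\<mu> 1) S q. x \<le> c}) -
      int (card {x \<in> plus_letters n (\<mu> 1) S (q + 1). x \<le> c}) \<in> {0, 1}) \<and>
    (\<forall>i\<in>{1..n}. Plain i \<in> plus_letters n (\<mu> 1) S 1 \<longleftrightarrow> Bar i \<notin> plus_letters n (\<mu> 1) S 1) \<and>
    (\<forall>q\<in>{1..\<mu> 1}. card (plus_letters n (\<mu> 1) S q) = diag_length n \<mu> q)"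
proof -
  let ?a = "phi_inv n \<mu> S" and ?P = "plus_letters n (\<mu> 1) S"
  have 1: "?a \<in> {1..2 * n} \<times> {1..\<mu> 1} \<rightarrow>\<^sub>E {-1, 0, 1}"
    by (auto simp: phi_inv_def split: if_splits simp del: One_nat_def)
  have 2: "\<forall>i\<in>{1..2 * n}. \<forall>p\<in>{1..\<mu> 1}. (\<Sum>q=p..\<mu> 1. ?a (i, q)) \<in> {0, 1}"
    by (simp add: row_sum_phi_inv del: One_nat_def)
  have 3: "(\<forall>j\<in>{1..2 * n}. \<forall>q\<in>{1..\<mu> 1}. (\<Sum>i=j..2 * n. ?a (i, q)) \<in> {0, 1}) \<longleftrightarrow>
    (\<forall>c\<in>alphabet n. \<forall>q\<in>{1..\<mu> 1}. int (card {x \<in> ?P q. x \<le> c}) -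
      int (card {x \<in> ?P (q + 1). x \<le> c}) \<in> {0, 1})"
  proof -
    have "alphabet n = row_label n ` {1..2 * n}"
      using bij_betw_row_label[of n] by (simp add: bij_betw_def)
    then show ?thesis by (simp only: ball_simps column_sum_phi_inv cong: ball_cong)
  qed
  have 4: "(\<forall>i\<in>{1..n}. (\<Sum>q=1..\<mu> 1. ?a (2 * i - 1, q) + ?a (2 * i, q)) = 1) \<longleftrightarrow>
    (\<forall>i\<in>{1..n}. Plain i \<in> ?P 1 \<longleftrightarrow> Bar i \<notin> ?P 1)"
  proof -
    \<comment> \<open>Rows \<open>2 * i - 1\<close> and \<open>2 * i\<close> carry the two letters
      of index \<open>n + 1 - i\<close>, and a full row sum is the indicator of its label in the
      first column.\<close>
    have sum: "(\<Sum>q=1..\<mu> 1. ?a (2 * i - 1, q) + ?a (2 * i, q)) =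
      of_bool (Plain (n + 1 - i) \<in> ?P 1) + of_bool (Bar (n + 1 - i) \<in> ?P 1)" if "i \<in> {1..n}" for i
    proof -
      have "(2 * i - 1 - 1) div 2 = i - 1" "(2 * i - 1) div 2 = i - 1" "odd (2 * i - 1)"
        using that by auto
      then have "row_label n (2 * i - 1) = Plain (n + 1 - i)" "row_label n (2 * i) = Bar (n + 1 - i)"
        using that by (auto simp: row_label_def)
      moreover have "2 * i - 1 \<in> {1..2 * n}" "2 * i \<in> {1..2 * n}" "1 \<in> {1..\<mu> 1}"
        using that parts_1_pos by auto
      ultimately show ?thesis using row_sum_phi_inv[of _ n 1 \<mu> S] by (simp only: sum.distrib)
    qed
    \<comment> \<open>Row pairs are numbered downwards and letter indices upwards, so the quantifier
      has to be reindexed.\<close>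
    have reverse: "(\<forall>i\<in>{1..n}. Q (n + 1 - i)) \<longleftrightarrow> (\<forall>i\<in>{1..n}. Q i)" for Q
    proof (intro iffI ballI)
      fix i assume Q: "\<forall>i\<in>{1..n}. Q (n + 1 - i)" and i: "i \<in> {1..n}"
      have "n + 1 - i \<in> {1..n}" "n + 1 - (n + 1 - i) = i" using i by auto
      then show "Q i" using Q by metis
    next
      fix i assume Q: "\<forall>i\<in>{1..n}. Q i" and i: "i \<in> {1..n}"
      then have "n + 1 - i \<in> {1..n}" by auto
      then show "Q (n + 1 - i)" using Q by blast
    qed
    have "(\<forall>i\<in>{1..n}. (\<Sum>q=1..\<mu> 1. ?a (2 * i - 1, q) + ?a (2 * i, q)) = 1) \<longleftrightarrow>
      (\<forall>i\<in>{1..n}. Plain (n + 1 - i) \<in> ?P 1 \<longleftrightarrow> Bar (n + 1 - i) \<notin> ?P 1)"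
      by (intro ball_cong refl, subst sum) (auto simp: of_bool_def)
    then show ?thesis using reverse[of "\<lambda>i. Plain i \<in> ?P 1 \<longleftrightarrow> Bar i \<notin> ?P 1"] by (simp only:)
  qed
  have 5: "(\<forall>q\<in>{1..\<mu> 1}. (\<Sum>i=1..2 * n. ?a (i, q)) = (if \<exists>k\<in>{1..n}. q = \<mu> k then 1 else 0)) \<longleftrightarrow>
    (\<forall>q\<in>{1..\<mu> 1}. card (?P q) = diag_length n \<mu> q)"
  proof -
    \<comment> \<open>The top row carries the greatest letter, so a column sum started there counts
      every letter.\<close>
    have all: "{x \<in> ?P q. x \<le> row_label n 1} = ?P q" for q
      using plus_letters_subset[of n "\<mu> 1" S q] n
      by (auto simp: less_eq_letter_def rank_row_label mem_alphabet_iff subset_iff)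
    have "1 \<in> {1..2 * n}" using n by simp
    then have sum: "(\<Sum>i=1..2 * n. ?a (i, q)) = int (card (?P q)) - int (card (?P (q + 1)))"
      if "q \<in> {1..\<mu> 1}" for q
      using column_sum_phi_inv[of 1 n q \<mu> S] that by (simp only: all)
    have "card (?P (\<mu> 1 + 1)) = 0" by (simp add: plus_letters_def)
    from card_steps_iff[of "\<lambda>q. card (?P q)", OF this] show ?thesis
      by (simp only: sum cong: ball_cong)
  qed
  show ?thesis unfolding UA_def mem_Collect_eq 3 4 5 using 1 2 by blast
qed

section \<open>Tableaux by diagonals\<close>

abbreviation diagonal :: "(nat \<times> nat \<Rightarrow> letter) \<Rightarrow> nat \<Rightarrow> nat \<Rightarrow> letter" where
  "diagonal \<eta> q i \<equiv> \<eta> (i, i + q - 1)"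

text \<open>Forwards, a letter of index \<open>i\<close> can occur only at position
  \<open>i\<close>, so exactly one of the two does. Backwards, picking the letter of each index that
  is present gives an increasing enumeration \<open>h\<close> of the same set, and
  \<open>strict_mono_on_unique\<close> forces \<open>f\<close> to agree with it.\<close>

lemma main_diagonal_iff:
  assumes f: "strict_mono_on {1..n} f" and A: "f ` {1..n} \<subseteq> alphabet n"
  shows "(\<forall>i\<in>{1..n}. f i \<in> {Plain i, Bar i}) \<longleftrightarrow>
    (\<forall>i\<in>{1..n}. Plain i \<in> f ` {1..n} \<longleftrightarrow> Bar i \<notin> f ` {1..n})" (is "?L \<longleftrightarrow> ?R")
proof
  assume L: ?L
  have mem: "c \<in> f ` {1..n} \<longleftrightarrow> f i = c" if "i \<in> {1..n}" "c \<in> {Plain i, Bar i}" for i c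
  proof
    assume "c \<in> f ` {1..n}"
    then obtain j where j: "j \<in> {1..n}" "c = f j" by blast
    then have "j = i" using L that by fastforce
    then show "f i = c" using j by simp
  qed (use that in auto)
  show ?R
  proof
    fix i assume "i \<in> {1..n}"
    then show "Plain i \<in> f ` {1..n} \<longleftrightarrow> Bar i \<notin> f ` {1..n}"
      using L mem[of i "Plain i"] mem[of i "Bar i"] by auto
  qed
next
  assume R: ?R
  define D where "D = f ` {1..n}"
  have D: "Plain i \<in> D \<longleftrightarrow> Bar i \<notin> D" if "i \<in> {1..n}" for i using R that by (simp only: D_def)
  define h where "h i = (if Plain i \<in> D then Plain i else Bar i)" for i
  have h: "strict_mono_on {1..n} h"
    by (auto intro!: strict_mono_onI simp: h_def less_letter_def)
  have "h ` {1..n} = D"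
  proof (intro equalityI subsetI)
    fix c assume "c \<in> h ` {1..n}"
    then show "c \<in> D" using D by (auto simp: h_def)
  next
    fix c assume c: "c \<in> D"
    then obtain i where i: "i \<in> {1..n}" "c = Plain i \<or> c = Bar i"
      using A by (auto simp: D_def alphabet_def)
    then have "h i = c" using D c by (auto simp: h_def)
    then show "c \<in> h ` {1..n}" using i by blast
  qed
  then have "f i = h i" if "i \<in> {1..n}" for i
    using strict_mono_on_unique[OF f h _ that] by (simp only: D_def)
  then show ?L by (simp add: h_def)
qed

text \<open>The two boxes compared are neighbours on one diagonal; transitivity extends the
  comparison to any two positions.\<close>

lemma diagonals_strict_mono_iff:
  "(\<forall>i j. (i, j) \<in> SF n \<mu> \<and> (i + 1, j + 1) \<in> SF n \<mu> \<longrightarrow> \<eta> (i, j) < \<eta> (i + 1, j + 1)) \<longleftrightarrow>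
    (\<forall>q\<in>{1..\<mu> 1}. strict_mono_on {1..diag_length n \<mu> q} (diagonal \<eta> q))" (is "?L \<longleftrightarrow> ?R")
proof
  assume L: ?L
  show ?R
  proof (intro ballI strict_mono_onI)
    fix q i j assume q: "q \<in> {1..\<mu> 1}" and i: "i \<in> {1..diag_length n \<mu> q}"
      and j: "j \<in> {1..diag_length n \<mu> q}" and ij: "i < j"
    have "Suc i \<le> j" using ij by simp
    then show "diagonal \<eta> q i < diagonal \<eta> q j" using j
    proof (induction rule: dec_induct)
      case base
      then show ?case
        using L[rule_format, of i "i + q - 1"] mem_SF_diag_iff[of q i] mem_SF_diag_iff[of q "i + 1"] i q
        by auto
    next
      case (step k)
      have "diagonal \<eta> q k < diagonal \<eta> q (Suc k)"
        using L[rule_format, of k "k + q - 1"] mem_SF_diag_iff[of q k] mem_SF_diag_iff[of q "k + 1"]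
          i q step.hyps step.prems by auto
      then show ?case using step by auto
    qed
  qed
next
  assume R: ?R
  show ?L
  proof (intro allI impI, elim conjE)
    fix i j assume ij: "(i, j) \<in> SF n \<mu>" "(i + 1, j + 1) \<in> SF n \<mu>"
    from ij(1) obtain q where q: "q \<in> {1..\<mu> 1}" "j = i + q - 1" "1 \<le> i" "i \<le> diag_length n \<mu> q"
      by (rule SF_cases)
    then have j: "j + 1 = i + 1 + q - 1" by auto
    then have "i + 1 \<le> diag_length n \<mu> q" using ij(2) mem_SF_diag_iff[of q "i + 1"] q by auto
    then have "diagonal \<eta> q i < diagonal \<eta> q (i + 1)"
      using R q by (intro strict_mono_onD[of "{1..diag_length n \<mu> q}" "diagonal \<eta> q"]) auto
    then show "\<eta> (i, j) < \<eta> (i + 1, j + 1)" using q j by simp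
  qed
qed

text \<open>A step to the right goes from diagonal \<open>q\<close> to \<open>q + 1\<close> and
  keeps the position. The left box is present because lengths never increase with
  \<open>q\<close>.\<close>

lemma rows_weakly_increasing_iff:
  "(\<forall>i j. (i, j) \<in> SF n \<mu> \<and> (i, j + 1) \<in> SF n \<mu> \<longrightarrow> \<eta> (i, j) \<le> \<eta> (i, j + 1)) \<longleftrightarrow>
    (\<forall>q\<in>{1..\<mu> 1}. \<forall>i. 1 \<le> i \<and> i \<le> diag_length n \<mu> (q + 1) \<longrightarrow>
      diagonal \<eta> q i \<le> diagonal \<eta> (q + 1) i)" (is "?L \<longleftrightarrow> ?R")
proof
  assume L: ?L
  show ?R
  proof (intro ballI allI impI)
    fix q i assume q: "q \<in> {1..\<mu> 1}" and i: "1 \<le> i \<and> i \<le> diag_length n \<mu> (q + 1)"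
    then have "i \<le> diag_length n \<mu> q" using diag_length_step[of q] by simp
    then show "diagonal \<eta> q i \<le> diagonal \<eta> (q + 1) i"
      using L[rule_format, of i "i + q - 1"] mem_SF_diag_iff[of q i] mem_SF_diag_iff[of "q + 1" i] i q
      by auto
  qed
next
  assume R: ?R
  show ?L
  proof (intro allI impI, elim conjE)
    fix i j assume ij: "(i, j) \<in> SF n \<mu>" "(i, j + 1) \<in> SF n \<mu>"
    from ij(1) obtain q where q: "q \<in> {1..\<mu> 1}" "j = i + q - 1" "1 \<le> i" "i \<le> diag_length n \<mu> q"
      by (rule SF_cases)
    then have j: "j + 1 = i + (q + 1) - 1" by auto
    then have "i \<le> diag_length n \<mu> (q + 1)" using ij(2) mem_SF_diag_iff[of "q + 1" i] q by auto
    then show "\<eta> (i, j) \<le> \<eta> (i, j + 1)" using R q j by metis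
  qed
qed

text \<open>A step down goes from diagonal \<open>q + 1\<close> to \<open>q\<close> and raises the
  position by one. The upper box is present because consecutive lengths differ by at most
  one.\<close>

lemma columns_weakly_increasing_iff:
  "(\<forall>i j. (i, j) \<in> SF n \<mu> \<and> (i + 1, j) \<in> SF n \<mu> \<longrightarrow> \<eta> (i, j) \<le> \<eta> (i + 1, j)) \<longleftrightarrow>
    (\<forall>q\<in>{1..\<mu> 1}. \<forall>i. 1 \<le> i \<and> i + 1 \<le> diag_length n \<mu> q \<longrightarrow>
      diagonal \<eta> (q + 1) i \<le> diagonal \<eta> q (i + 1))" (is "?L \<longleftrightarrow> ?R")
proof
  assume L: ?L
  show ?R
  proof (intro ballI allI impI)
    fix q i assume q: "q \<in> {1..\<mu> 1}" and i: "1 \<le> i \<and> i + 1 \<le> diag_length n \<mu> q"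
    then have "i \<le> diag_length n \<mu> (q + 1)" using diag_length_step[of q] by (simp split: if_splits)
    then show "diagonal \<eta> (q + 1) i \<le> diagonal \<eta> q (i + 1)"
      using L[rule_format, of i "i + q"] mem_SF_diag_iff[of q "i + 1"] mem_SF_diag_iff[of "q + 1" i] i q
      by auto
  qed
next
  assume R: ?R
  show ?L
  proof (intro allI impI, elim conjE)
    fix i j assume ij: "(i, j) \<in> SF n \<mu>" "(i + 1, j) \<in> SF n \<mu>"
    from ij(2) obtain q where q: "q \<in> {1..\<mu> 1}" "j = i + 1 + q - 1" "i + 1 \<le> diag_length n \<mu> q"
      by (rule SF_cases)
    then have "j = i + (q + 1) - 1" by auto
    moreover have "1 \<le> i" using ij(1) by (auto simp: SF_def)
    ultimately show "\<eta> (i, j) \<le> \<eta> (i + 1, j)" using R q by metis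
  qed
qed

lemma alphabet_valued_iff:
  assumes "\<eta> \<in> extensional (SF n \<mu>)"
  shows "\<eta> \<in> SF n \<mu> \<rightarrow>\<^sub>E alphabet n \<longleftrightarrow>
    (\<forall>q\<in>{1..\<mu> 1}. diagonal \<eta> q ` {1..diag_length n \<mu> q} \<subseteq> alphabet n)" (is "?L \<longleftrightarrow> ?R")
proof
  assume ?L
  then show ?R using mem_SF_diag_iff by auto
next
  assume R: ?R
  show ?L
  proof (rule PiE_I)
    fix x assume "x \<in> SF n \<mu>"
    then obtain i j where x: "x = (i, j)" "(i, j) \<in> SF n \<mu>" by (cases x) auto
    from x(2) obtain q where "q \<in> {1..\<mu> 1}" "j = i + q - 1" "1 \<le> i" "i \<le> diag_length n \<mu> q"
      by (rule SF_cases)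
    then have "\<eta> x \<in> diagonal \<eta> q ` {1..diag_length n \<mu> q}" using x by auto
    then show "\<eta> x \<in> alphabet n" using R \<open>q \<in> {1..\<mu> 1}\<close> by blast
  qed (use assms in \<open>auto simp: extensional_def\<close>)
qed

text \<open>For fillings with increasing diagonals in the alphabet, the row and column conditions
  together are interlacing of consecutive diagonals. What remains speaks only of the letter sets and
  matches the first two conjuncts of \<open>phi_inv_mem_UA_iff\<close>.\<close>

lemma mem_ST_iff:
  assumes ext: "\<eta> \<in> extensional (SF n \<mu>)"
    and sm: "\<forall>q\<in>{1..\<mu> 1}. strict_mono_on {1..diag_length n \<mu> q} (diagonal \<eta> q)"
    and A: "\<forall>q\<in>{1..\<mu> 1}. diagonal \<eta> q ` {1..diag_length n \<mu> q} \<subseteq> alphabet n"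
  shows "\<eta> \<in> ST n \<mu> \<longleftrightarrow>
    (\<forall>c\<in>alphabet n. \<forall>q\<in>{1..\<mu> 1}.
      int (card {x \<in> diagonal \<eta> q ` {1..diag_length n \<mu> q}. x \<le> c}) -
      int (card {x \<in> diagonal \<eta> (q + 1) ` {1..diag_length n \<mu> (q + 1)}. x \<le> c}) \<in> {0, 1}) \<and>
    (\<forall>i\<in>{1..n}. Plain i \<in> diagonal \<eta> 1 ` {1..n} \<longleftrightarrow> Bar i \<notin> diagonal \<eta> 1 ` {1..n})"
proof -
  let ?l = "diag_length n \<mu>"
  \<comment> \<open>The range includes the empty diagonal \<open>\<mu> 1 + 1\<close>, so that the
    last diagonal also has a right-hand neighbour to interlace with.\<close>
  have sm': "strict_mono_on {1..?l q} (diagonal \<eta> q) \<and> diagonal \<eta> q ` {1..?l q} \<subseteq> alphabet n"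
    if "1 \<le> q" "q \<le> \<mu> 1 + 1" for q
    using sm A that diag_length_beyond by (cases "q = \<mu> 1 + 1") (auto simp: strict_mono_on_def)
  let ?row = "\<lambda>q. \<forall>i. 1 \<le> i \<and> i \<le> ?l (q + 1) \<longrightarrow> diagonal \<eta> q i \<le> diagonal \<eta> (q + 1) i"
  let ?col = "\<lambda>q. \<forall>i. 1 \<le> i \<and> i + 1 \<le> ?l q \<longrightarrow> diagonal \<eta> (q + 1) i \<le> diagonal \<eta> q (i + 1)"
  let ?N = "\<lambda>q c. int (card {x \<in> diagonal \<eta> q ` {1..?l q}. x \<le> c})"
  have "?row q \<and> ?col q \<longleftrightarrow> (\<forall>c\<in>alphabet n. ?N q c - ?N (q + 1) c \<in> {0, 1})"
    if "q \<in> {1..\<mu> 1}" for q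
    using that sm'[of q] sm'[of "q + 1"] diag_length_step[of q] by (intro interlacing_iff) auto
  then have "(\<forall>q\<in>{1..\<mu> 1}. ?row q \<and> ?col q) \<longleftrightarrow>
    (\<forall>q\<in>{1..\<mu> 1}. \<forall>c\<in>alphabet n. ?N q c - ?N (q + 1) c \<in> {0, 1})"
    by (rule ball_cong[OF refl])
  then have interlacing: "(\<forall>q\<in>{1..\<mu> 1}. ?row q) \<and> (\<forall>q\<in>{1..\<mu> 1}. ?col q) \<longleftrightarrow>
    (\<forall>c\<in>alphabet n. \<forall>q\<in>{1..\<mu> 1}. ?N q c - ?N (q + 1) c \<in> {0, 1})"
    unfolding ball_conj_distrib by (rule trans) blast
  have main: "(\<forall>i\<in>{1..n}. \<eta> (i, i) \<in> {Plain i, Bar i}) \<longleftrightarrow>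
    (\<forall>i\<in>{1..n}. Plain i \<in> diagonal \<eta> 1 ` {1..n} \<longleftrightarrow> Bar i \<notin> diagonal \<eta> 1 ` {1..n})"
    using main_diagonal_iff[of "diagonal \<eta> 1"] sm'[of 1] diag_length_1 by simp
  have valued: "\<eta> \<in> SF n \<mu> \<rightarrow>\<^sub>E alphabet n" using alphabet_valued_iff[OF ext] A by blast
  show ?thesis
    unfolding ST_def mem_Collect_eq diagonals_strict_mono_iff rows_weakly_increasing_iff
      columns_weakly_increasing_iff main interlacing[symmetric]
    by (insert sm valued, (intro iffI conjI; elim conjE; assumption))
qed

lemma ST_diagonals:
  assumes "\<eta> \<in> ST n \<mu>"
  shows "\<eta> \<in> extensional (SF n \<mu>)"
    and "\<forall>q\<in>{1..\<mu> 1}. strict_mono_on {1..diag_length n \<mu> q} (diagonal \<eta> q)"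
    and "\<forall>q\<in>{1..\<mu> 1}. diagonal \<eta> q ` {1..diag_length n \<mu> q} \<subseteq> alphabet n"
proof -
  have \<eta>: "\<eta> \<in> SF n \<mu> \<rightarrow>\<^sub>E alphabet n" using assms by (simp add: ST_def)
  then show ext: "\<eta> \<in> extensional (SF n \<mu>)" by (simp add: PiE_iff)
  show "\<forall>q\<in>{1..\<mu> 1}. diagonal \<eta> q ` {1..diag_length n \<mu> q} \<subseteq> alphabet n"
    using alphabet_valued_iff[OF ext] \<eta> by blast
  show "\<forall>q\<in>{1..\<mu> 1}. strict_mono_on {1..diag_length n \<mu> q} (diagonal \<eta> q)"
    using assms unfolding diagonals_strict_mono_iff[symmetric] ST_def by blast
qed

section \<open>From tableaux to matrices and back\<close>

lemma plus_letters_psi: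
  assumes A: "\<forall>q\<in>{1..\<mu> 1}. diagonal \<eta> q ` {1..diag_length n \<mu> q} \<subseteq> alphabet n"
    and q: "q \<in> {1..\<mu> 1 + 1}"
  shows "plus_letters n (\<mu> 1) (psi n \<mu> \<eta>) q = diagonal \<eta> q ` {1..diag_length n \<mu> q}"
proof (cases "q = \<mu> 1 + 1")
  case True
  then show ?thesis using diag_length_beyond by (simp add: plus_letters_def)
next
  case False
  then have q: "q \<in> {1..\<mu> 1}" using q by auto
  let ?D = "diagonal \<eta> q ` {1..diag_length n \<mu> q}"
  have SF: "(i, i + q - 1) \<in> SF n \<mu> \<longleftrightarrow> i \<in> {1..diag_length n \<mu> q}" for i
    using q mem_SF_diag_iff[of q i] by simp
  have "psi n \<mu> \<eta> (r, q) = Plus \<longleftrightarrow> row_label n r \<in> ?D" if "r \<in> {1..2 * n}" for r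
  proof -
    have "psi n \<mu> \<eta> (r, q) = Plus \<longleftrightarrow>
      (\<exists>i. (i, i + q - 1) \<in> SF n \<mu> \<and> diagonal \<eta> q i = row_label n r)"
      using q that by (simp add: psi_def)
    then show ?thesis unfolding SF by (metis (no_types, lifting) image_iff)
  qed
  then have "plus_letters n (\<mu> 1) (psi n \<mu> \<eta>) q = row_label n ` {1..2 * n} \<inter> ?D"
    using q by (auto simp: plus_letters_def simp del: One_nat_def)
  then show ?thesis using bij_betw_imp_surj_on[OF bij_betw_row_label[of n]] A q by blast
qed

text \<open>The two characterisations coincide once letter sets are identified; the cardinality
  condition is automatic since increasing diagonals are injective. As \<open>\<eta>\<close> is not
  assumed to be a tableau, this serves both inclusions between the image and
  \<open>UA n \<mu>\<close>.\<close>

lemma Psi_mem_UA_iff: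
  assumes ext: "\<eta> \<in> extensional (SF n \<mu>)"
    and sm: "\<forall>q\<in>{1..\<mu> 1}. strict_mono_on {1..diag_length n \<mu> q} (diagonal \<eta> q)"
    and A: "\<forall>q\<in>{1..\<mu> 1}. diagonal \<eta> q ` {1..diag_length n \<mu> q} \<subseteq> alphabet n"
  shows "Psi n \<mu> \<eta> \<in> UA n \<mu> \<longleftrightarrow> \<eta> \<in> ST n \<mu>"
proof -
  have P: "plus_letters n (\<mu> 1) (psi n \<mu> \<eta>) q = diagonal \<eta> q ` {1..diag_length n \<mu> q}"
    "plus_letters n (\<mu> 1) (psi n \<mu> \<eta>) (q + 1) = diagonal \<eta> (q + 1) ` {1..diag_length n \<mu> (q + 1)}"
    if "q \<in> {1..\<mu> 1}" for q
    using that by (intro plus_letters_psi[OF A]; simp)+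
  have P1: "plus_letters n (\<mu> 1) (psi n \<mu> \<eta>) 1 = diagonal \<eta> 1 ` {1..n}"
    using plus_letters_psi[OF A, of 1] diag_length_1 by simp
  have card: "card (diagonal \<eta> q ` {1..diag_length n \<mu> q}) = diag_length n \<mu> q"
    if "q \<in> {1..\<mu> 1}" for q
    using sm that strict_mono_on_imp_inj_on card_image by fastforce
  show ?thesis
    unfolding Psi_def comp_def phi_inv_mem_UA_iff mem_ST_iff[OF assms]
    by (simp only: P P1 card simp_thms ball_triv cong: ball_cong)
qed

lemma psi_extensional: "psi n \<mu> \<eta> \<in> extensional ({1..2 * n} \<times> {1..\<mu> 1})"
  by (simp add: psi_def)

text \<open>Applying \<open>phi\<close> recovers the sign matrix, hence the letter set of each
  diagonal, and a set has only one increasing enumeration.\<close>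

lemma Psi_inj_on: "inj_on (Psi n \<mu>) (ST n \<mu>)"
proof (rule inj_onI)
  fix \<eta> \<theta> assume \<eta>: "\<eta> \<in> ST n \<mu>" and \<theta>: "\<theta> \<in> ST n \<mu>" and "Psi n \<mu> \<eta> = Psi n \<mu> \<theta>"
  moreover have "phi n \<mu> (Psi n \<mu> \<zeta>) = psi n \<mu> \<zeta>" for \<zeta>
    unfolding Psi_def comp_def by (rule phi_phi_inv, rule psi_extensional)
  ultimately have psi: "psi n \<mu> \<eta> = psi n \<mu> \<theta>" by metis
  show "\<eta> = \<theta>"
  proof (rule extensionalityI[OF ST_diagonals(1)[OF \<eta>] ST_diagonals(1)[OF \<theta>]])
    fix x assume "x \<in> SF n \<mu>"
    then obtain i j where x: "x = (i, j)" "(i, j) \<in> SF n \<mu>" by (cases x) auto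
    from x(2) obtain q where q: "q \<in> {1..\<mu> 1}" "j = i + q - 1" "1 \<le> i" "i \<le> diag_length n \<mu> q"
      by (rule SF_cases)
    have eq: "diagonal \<eta> q ` {1..diag_length n \<mu> q} = diagonal \<theta> q ` {1..diag_length n \<mu> q}"
      using plus_letters_psi[OF ST_diagonals(3)[OF \<eta>], of q]
        plus_letters_psi[OF ST_diagonals(3)[OF \<theta>], of q] psi q by auto
    have "diagonal \<eta> q i = diagonal \<theta> q i"
      using strict_mono_on_unique[OF bspec[OF ST_diagonals(2)[OF \<eta>] q(1)]
          bspec[OF ST_diagonals(2)[OF \<theta>] q(1)] eq, of i] q by simp
    then show "\<eta> x = \<theta> x" using x q by simp
  qed
qed

text \<open>The preimage lists the \<open>Plus\<close> letters of each column of
  \<open>phi n \<mu> a\<close> increasingly along the corresponding diagonal. The cardinality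
  condition ensures that each list fills its diagonal exactly.\<close>

lemma UA_subset_Psi_image: "UA n \<mu> \<subseteq> Psi n \<mu> ` ST n \<mu>"
proof
  fix a assume a: "a \<in> UA n \<mu>"
  let ?S = "phi n \<mu> a" and ?l = "diag_length n \<mu>"
  let ?P = "plus_letters n (\<mu> 1) ?S"
  have S: "phi_inv n \<mu> ?S = a" by (rule phi_inv_phi[OF a])
  then have card: "card (?P q) = ?l q" if "q \<in> {1..\<mu> 1}" for q
    using a phi_inv_mem_UA_iff[of ?S] that by simp
  have "\<exists>f. strict_mono_on {1..?l q} f \<and> f ` {1..?l q} = ?P q" if "q \<in> {1..\<mu> 1}" for q
    using strict_mono_on_enumeration[of "?P q"] card[OF that]
      finite_subset[OF plus_letters_subset finite_alphabet] by metis
  then obtain f where f: "strict_mono_on {1..?l q} (f q)" "f q ` {1..?l q} = ?P q"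
    if "q \<in> {1..\<mu> 1}" for q by metis
  \<comment> \<open>Box \<open>(i, j)\<close> is at position \<open>i\<close> on diagonal
    \<open>j - i + 1\<close>.\<close>
  define \<eta> where "\<eta> = restrict (\<lambda>(i, j). f (j - i + 1) i) (SF n \<mu>)"
  have \<eta>: "diagonal \<eta> q i = f q i" if "q \<in> {1..\<mu> 1}" "i \<in> {1..?l q}" for q i
    using mem_SF_diag_iff[of q i] that by (simp add: \<eta>_def)
  have ext: "\<eta> \<in> extensional (SF n \<mu>)" by (simp add: \<eta>_def)
  have sm: "\<forall>q\<in>{1..\<mu> 1}. strict_mono_on {1..?l q} (diagonal \<eta> q)"
    using f(1) \<eta> by (simp add: strict_mono_on_def)
  have D: "diagonal \<eta> q ` {1..?l q} = ?P q" if "q \<in> {1..\<mu> 1}" for q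
    using f(2)[OF that] \<eta>[OF that] by (metis (no_types, lifting) image_cong)
  then have A: "\<forall>q\<in>{1..\<mu> 1}. diagonal \<eta> q ` {1..?l q} \<subseteq> alphabet n"
    using plus_letters_subset by metis
  have "psi n \<mu> \<eta> = ?S"
  proof (rule sign_matrix_eqI[OF psi_extensional])
    show "?S \<in> extensional ({1..2 * n} \<times> {1..\<mu> 1})" by (simp add: phi_def)
    show "plus_letters n (\<mu> 1) (psi n \<mu> \<eta>) q = ?P q" if "q \<in> {1..\<mu> 1}" for q
      using plus_letters_psi[OF A, of q] D[OF that] that by simp
  qed
  then have "Psi n \<mu> \<eta> = a" using S by (simp add: Psi_def)
  moreover from this have "\<eta> \<in> ST n \<mu>" using Psi_mem_UA_iff[OF ext sm A] a by simp
  ultimately show "a \<in> Psi n \<mu> ` ST n \<mu>" by blast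
qed

lemma Psi_image_subset_UA: "Psi n \<mu> ` ST n \<mu> \<subseteq> UA n \<mu>"
proof (rule image_subsetI)
  fix \<eta> assume \<eta>: "\<eta> \<in> ST n \<mu>"
  then show "Psi n \<mu> \<eta> \<in> UA n \<mu>"
    using Psi_mem_UA_iff[of \<eta>] ST_diagonals[OF \<eta>] by blast
qed

end

theorem theorem4p1:
  fixes n :: nat and \<mu> :: "nat \<Rightarrow> nat"
  assumes "n \<ge> 1" and "strict_partition n \<mu>"
  shows "bij_betw (Psi n \<mu>) (ST n \<mu>) (UA n \<mu>)"
  using Psi_inj_on[OF assms] UA_subset_Psi_image[OF assms] Psi_image_subset_UA[OF assms]
  by (intro bij_betw_imageI) auto

end
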